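(* Consider any robust optimization problem with ellipsoidal uncertainty sets, with robust counterpart $$\text{(RC)}\qquad \min_{x}\ c^T x\quad\text{s.t.}\quad g_i(x):=a_i^T x+\beta_i\sqrt{x^T\Sigma_i x}\le 0\ (i=1,\ldots,m),\quad \ell\le x\le u,\quad x_j\in\mathbb{Z}\ (1\le j\le k),$$ and assume (RC) has a solution. Let $\varepsilon>0$. Then the sequence of points $x_1,x_2,\ldots$ generated by the cutting-plane algorithm (described in the context) with tolerance $\varepsilon$ converges to a solution of (RC) in a finite number of steps within tolerance $\varepsilon$. That is, there is a finite iteration index $L$ at which the algorithm stops, and the returned point $x_L$ is a solution of (RC) within tolerance $\varepsilon$: either $x_L$ is an optimal solution of (RC), or $x_L$ satisfies $\ell\le x_L\le u$, $(x_L)_j\in\mathbb{Z}$ for $1\le j\le k$, $g_i(x_L)<\varepsilon$ for all $i=1,\ldots,m$, and $c^Tx_L$ is at most the optimal value of (RC).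
   Context: Data: integers $n\ge 1$, $m\ge 1$, $1\le k\le n$; vectors $c\in\mathbb{R}^n$; finite bounds $\ell,u\in\mathbb{R}^n$ (so the set of $x$ with $\ell\le x\le u$ is compact); nominal coefficient vectors $a_i\in\mathbb{R}^n$, real parameters $\beta_i>0$ and symmetric positive-definite matrices $\Sigma_i\in\mathbb{R}^{n\times n}$ for $i=1,\ldots,m$. The decision vector is $x\in\mathbb{R}^n$, whose first $k$ components are required to be integers. The underlying robust problem is: minimize $c^Tx$ subject to $\tilde a_i^T x\le 0$ for all $\tilde a_i\in U_i$, $i=1,\ldots,m$, $\ell\le x\le u$, $x_j\in\mathbb{Z}$ for $1\le j\le k$, where $U_i$ is the ellipsoidal uncertainty set centred at $a_i$ determined by $\beta_i$ and $\Sigma_i$, so that $\max_{\tilde a_i\in U_i}\tilde a_i^T x=a_i^Tx+\beta_i\sqrt{x^T\Sigma_i x}$. Its robust counterpart is the problem (RC) in the claim. Cutting-plane algorithm with tolerance $\varepsilon>0$: Step 0 (initialization). Set $l=0$ and $\hat a_i^{(0)}=a_i$ for all $i$. Step 1 (master problem). Replace $l$ by $l+1$ and let $x_l$ be an optimal solution of the mixed-integer linear problem: minimize $c^Tx$ subject to $(\hat a_i^{(\nu)})^T x\le 0$ for $i=1,\ldots,m$ and $\nu=0,1,\ldots,l-1$; $\ell\le x\le u$; $x_j\in\mathbb{Z}$ for $1\le j\le k$. Step 2 (stopping rule). If $g_i(x_l)\le 0$ for all $i$, stop: $x_l$ is returned as the optimal solution. Otherwise, if $g_i(x_l)<\varepsilon$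 for all $i$, stop and return $x_l$. Otherwise go to Step 3. Step 3 (subproblems). Set $$\hat a_i^{(l)}=a_i+\beta_i\frac{\Sigma_i x_l}{\sqrt{x_l^T\Sigma_i x_l}},\qquad i=1,\ldots,m,$$ and return to Step 1. (Step 3 is reached only with $x_l\neq 0$, since $x_l=0$ satisfies $g_i(x_l)=0$ for all $i$; moreover $(\hat a_i^{(l)})^Tx_l=g_i(x_l)$ when $x_l\ne 0$.) *)

theory Defs
  imports "HOL-Analysis.Analysis"
begin

definition pos_definite :: "real ^ 'n ^ 'n \<Rightarrow> bool" where
  "pos_definite S \<longleftrightarrow> (\<forall>x. x \<noteq> 0 \<longrightarrow> x \<bullet> (S *v x) > 0)"

(* Below, the index type 'n of R^n is also linearly ordered, so that "the first k components" makes
   sense; constraints are indexed by the naturals 1, ..., num_cons P. *)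
record ('n :: finite) robust_problem =
  num_int :: nat
  num_cons :: nat
  cost :: "real ^ 'n"
  lower :: "real ^ 'n"
  upper :: "real ^ 'n"
  nominal :: "nat \<Rightarrow> real ^ 'n"
  radius :: "nat \<Rightarrow> real"
  shape :: "nat \<Rightarrow> real ^ 'n ^ 'n"

type_synonym 'n rvec = "(real, 'n) vec"

definition well_posed :: "('n :: {finite, linorder}) robust_problem \<Rightarrow> bool" where
  "well_posed P \<longleftrightarrow>
     1 \<le> num_int P \<and> num_int P \<le> CARD('n) \<and> 1 \<le> num_cons P \<and>
     (\<forall>i\<in>{1..num_cons P}. radius P i > 0 \<and>
        transpose (shape P i) = shape P i \<and> pos_definite (shape P i))"

definition first_indices :: "nat \<Rightarrow> 'n :: {finite, linorder} set" where
  "first_indices k = {j. card {i. i < j} < k}"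

(* The order on real ^ 'n is componentwise. *)
definition ground_set :: "('n :: {finite, linorder}) robust_problem \<Rightarrow> 'n rvec set" where
  "ground_set P =
     {x. lower P \<le> x \<and> x \<le> upper P \<and> (\<forall>j\<in>first_indices (num_int P). x $ j \<in> \<int>)}"

definition rc_fun :: "('n :: {finite, linorder}) robust_problem \<Rightarrow> nat \<Rightarrow> 'n rvec \<Rightarrow> real" where
  "rc_fun P i x = nominal P i \<bullet> x + radius P i * sqrt (x \<bullet> (shape P i *v x))"

definition rc_feasible :: "('n :: {finite, linorder}) robust_problem \<Rightarrow> 'n rvec set" where
  "rc_feasible P = {x \<in> ground_set P. \<forall>i\<in>{1..num_cons P}. rc_fun P i x \<le> 0}"

definition rc_optimal :: "('n :: {finite, linorder}) robust_problem \<Rightarrow> 'n rvec \<Rightarrow> bool" where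
  "rc_optimal P = is_arg_min (\<lambda>x. cost P \<bullet> x) (\<lambda>x. x \<in> rc_feasible P)"

definition rc_value :: "('n :: {finite, linorder}) robust_problem \<Rightarrow> real" where
  "rc_value P = (INF x\<in>rc_feasible P. cost P \<bullet> x)"

(* Below, x is the sequence of iterates x 1, x 2, ...; the entry x 0 is
   never used. The division by zero for x \<nu> = 0 does not matter: the algorithm stops at 0. *)
definition cut_coeff ::
    "('n :: {finite, linorder}) robust_problem \<Rightarrow> (nat \<Rightarrow> 'n rvec) \<Rightarrow> nat \<Rightarrow> nat \<Rightarrow> 'n rvec" where
  "cut_coeff P x i \<nu> =
     (if \<nu> = 0 then nominal P i
      else nominal P i +
        (radius P i / sqrt (x \<nu> \<bullet> (shape P i *v x \<nu>))) *\<^sub>R (shape P i *v x \<nu>))"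

definition master_feasible ::
    "('n :: {finite, linorder}) robust_problem \<Rightarrow> (nat \<Rightarrow> 'n rvec) \<Rightarrow> nat \<Rightarrow> 'n rvec set" where
  "master_feasible P x l =
     {y \<in> ground_set P. \<forall>i\<in>{1..num_cons P}. \<forall>\<nu><l. cut_coeff P x i \<nu> \<bullet> y \<le> 0}"

definition master_optimal ::
    "('n :: {finite, linorder}) robust_problem \<Rightarrow> (nat \<Rightarrow> 'n rvec) \<Rightarrow> nat \<Rightarrow> 'n rvec \<Rightarrow> bool" where
  "master_optimal P x l = is_arg_min (\<lambda>y. cost P \<bullet> y) (\<lambda>y. y \<in> master_feasible P x l)"

(* The two disjuncts are the two stopping tests, in the order in which they are applied. *)
definition stops_at :: "('n :: {finite, linorder}) robust_problem \<Rightarrow> real \<Rightarrow> 'n rvec \<Rightarrow> bool" where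
  "stops_at P \<epsilon> y \<longleftrightarrow>
     (\<forall>i\<in>{1..num_cons P}. rc_fun P i y \<le> 0) \<or> (\<forall>i\<in>{1..num_cons P}. rc_fun P i y < \<epsilon>)"

(* The algorithm performs (at least) N master steps and produces x 1, ..., x N. It is
   nondeterministic: any optimal solution of the master problem may be chosen. Entries of x
   beyond N are irrelevant. *)
definition cp_run ::
    "('n :: {finite, linorder}) robust_problem \<Rightarrow> real \<Rightarrow> nat \<Rightarrow> (nat \<Rightarrow> 'n rvec) \<Rightarrow> bool" where
  "cp_run P \<epsilon> N x \<longleftrightarrow>
     (\<forall>l\<in>{1..N}. master_optimal P x l (x l)) \<and> (\<forall>l\<in>{1..<N}. \<not> stops_at P \<epsilon> (x l))"

(* A full execution: iterates are produced for as long as the algorithm has not stopped.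
   Either it stops at some x L (and later entries are unconstrained), or it runs forever. *)
definition cp_execution ::
    "('n :: {finite, linorder}) robust_problem \<Rightarrow> real \<Rightarrow> (nat \<Rightarrow> 'n rvec) \<Rightarrow> bool" where
  "cp_execution P \<epsilon> x \<longleftrightarrow>
     (\<forall>N. (\<forall>l\<in>{1..<N}. \<not> stops_at P \<epsilon> (x l)) \<longrightarrow> cp_run P \<epsilon> N x)"

definition rc_solution_within ::
    "('n :: {finite, linorder}) robust_problem \<Rightarrow> real \<Rightarrow> 'n rvec \<Rightarrow> bool" where
  "rc_solution_within P \<epsilon> y \<longleftrightarrow>
     rc_optimal P y \<or>
     (y \<in> ground_set P \<and> (\<forall>i\<in>{1..num_cons P}. rc_fun P i y < \<epsilon>) \<and> cost P \<bullet> y \<le> rc_value P)"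

end

theory Submission
  imports Defs
begin

text \<open>
  By the Cauchy--Schwarz inequality for the inner product of \<open>\<Sigma>\<^sub>i\<close>, every cut satisfies
  \<open>\<hat>a\<^sub>i\<^sup>\<nu> \<bullet> w \<le> g\<^sub>i(w)\<close> for all \<open>w\<close>, with equality at \<open>w = x\<^sub>\<nu>\<close>. So the master problems are
  relaxations of (RC), solvable by compactness, and an iterate at which the algorithm stops costs at
  most the optimal value. If the algorithm does not stop at \<open>x\<^sub>\<nu>\<close>, then \<open>g\<^sub>i(x\<^sub>\<nu>) \<ge> \<epsilon>\<close> for some \<open>i\<close>, and
  every later \<open>x\<^sub>l\<close> satisfies \<open>\<hat>a\<^sub>i\<^sup>\<nu> \<bullet> x\<^sub>l \<le> 0\<close>, whence \<open>\<epsilon> \<le> \<hat>a\<^sub>i\<^sup>\<nu> \<bullet> (x\<^sub>\<nu> - x\<^sub>l) \<le> g\<^sub>i(x\<^sub>\<nu> - x\<^sub>l)\<close>. As the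
  \<open>g\<^sub>i\<close> are continuous and vanish at 0, the iterates are uniformly separated, which is impossible for
  an infinite sequence in a compact box.
\<close>

lemma symmetric_bilinear_commute:
  fixes S :: "real ^ 'n ^ 'n"
  assumes "transpose S = S"
  shows "x \<bullet> (S *v y) = y \<bullet> (S *v x)"
  by (metis assms dot_lmul_matrix inner_commute transpose_matrix_vector)

lemma pos_definite_nonneg: "pos_definite S \<Longrightarrow> 0 \<le> x \<bullet> (S *v x)"
  by (cases "x = 0") (auto simp: pos_definite_def less_imp_le)

lemma pos_definite_Cauchy_Schwarz_square:
  fixes S :: "real ^ 'n ^ 'n"
  assumes sym: "transpose S = S" and pd: "pos_definite S"
  shows "(y \<bullet> (S *v z))\<^sup>2 \<le> (y \<bullet> (S *v y)) * (z \<bullet> (S *v z))"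
proof (cases "y = 0")
  case False
  define p q r where "p = y \<bullet> (S *v y)" and "q = y \<bullet> (S *v z)" and "r = z \<bullet> (S *v z)"
  have "p > 0"
    using pd False by (simp add: pos_definite_def p_def)
  have "z \<bullet> (S *v y) = q"
    using symmetric_bilinear_commute[OF sym] by (simp add: q_def)
  \<comment> \<open>The vector is \<open>p\<close> times the part of \<open>z\<close> orthogonal to
    \<open>y\<close> in the inner product of \<open>S\<close>; the factor \<open>p\<close> avoids a
    division.\<close>
  then have "(p *\<^sub>R z - q *\<^sub>R y) \<bullet> (S *v (p *\<^sub>R z - q *\<^sub>R y)) = p * (p * r - q\<^sup>2)"
    by (simp add: matrix_vector_mult_diff_distrib matrix_vector_mult_scaleR inner_diff_left
        inner_diff_right p_def[symmetric] q_def[symmetric] r_def[symmetric])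
      (simp add: algebra_simps power2_eq_square)
  with pos_definite_nonneg[OF pd] have "0 \<le> p * (p * r - q\<^sup>2)"
    by metis
  with \<open>p > 0\<close> show ?thesis
    by (simp add: zero_le_mult_iff p_def q_def r_def)
qed simp

lemma pos_definite_Cauchy_Schwarz:
  fixes S :: "real ^ 'n ^ 'n"
  assumes "transpose S = S" and "pos_definite S"
  shows "y \<bullet> (S *v z) \<le> sqrt (y \<bullet> (S *v y)) * sqrt (z \<bullet> (S *v z))"
  using real_le_rsqrt[OF pos_definite_Cauchy_Schwarz_square[OF assms, of y z]]
  by (simp add: real_sqrt_mult)

lemma rc_fun_0 [simp]: "rc_fun P i 0 = 0"
  by (simp add: rc_fun_def)

lemma continuous_on_rc_fun: "continuous_on A (rc_fun P i)"
  unfolding rc_fun_def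
  by (intro continuous_intros linear_continuous_on_compose[OF _ matrix_vector_mul_linear])

lemma cut_coeff_inner_le_rc_fun:
  assumes wp: "well_posed P" and i: "i \<in> {1..num_cons P}"
  shows "cut_coeff P x i \<nu> \<bullet> w \<le> rc_fun P i w"
proof -
  define S where "S = shape P i"
  have sym: "transpose S = S" and pd: "pos_definite S" and rad: "radius P i > 0"
    using wp i by (auto simp: well_posed_def S_def)
  define s where "s = sqrt (x \<nu> \<bullet> (S *v x \<nu>))"
  have "s \<ge> 0" and "sqrt (w \<bullet> (S *v w)) \<ge> 0"
    using pos_definite_nonneg[OF pd] by (auto simp: s_def)
  have "(S *v x \<nu>) \<bullet> w / s \<le> sqrt (w \<bullet> (S *v w))"
  \<comment> \<open>For \<open>s = 0\<close> the quotient is 0 by the convention on division, and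
    only nonnegativity of the root remains.\<close>
  proof (cases "s = 0")
    case False
    with \<open>s \<ge> 0\<close> have "s > 0" by simp
    with pos_definite_Cauchy_Schwarz[OF sym pd, of w "x \<nu>"] show ?thesis
      by (simp add: s_def inner_commute pos_divide_le_eq)
  qed (use \<open>sqrt (w \<bullet> (S *v w)) \<ge> 0\<close> in simp)
  with rad have "radius P i * ((S *v x \<nu>) \<bullet> w / s) \<le> radius P i * sqrt (w \<bullet> (S *v w))"
    by (intro mult_left_mono) auto
  \<comment> \<open>At \<open>\<nu> = 0\<close> the cut is the nominal vector, and the root term
    only increases the right-hand side; at other \<open>\<nu>\<close> the scaled bound
    applies.\<close>
  with rad \<open>sqrt (w \<bullet> (S *v w)) \<ge> 0\<close> show ?thesis
    by (simp add: cut_coeff_def rc_fun_def inner_add_left S_def[symmetric] s_def[symmetric])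
qed

text \<open>Rests on \<open>t / sqrt t = sqrt t\<close> for \<open>t \<ge> 0\<close>, which at
  \<open>t = 0\<close> reads \<open>0 / 0 = 0\<close>; a zero iterate is thus no exception.\<close>

lemma cut_coeff_inner_self:
  assumes wp: "well_posed P" and i: "i \<in> {1..num_cons P}" and "\<nu> \<noteq> 0"
  shows "cut_coeff P x i \<nu> \<bullet> x \<nu> = rc_fun P i (x \<nu>)"
proof -
  have "0 \<le> x \<nu> \<bullet> (shape P i *v x \<nu>)"
    using wp i by (auto simp: well_posed_def intro: pos_definite_nonneg)
  with real_div_sqrt[OF this] \<open>\<nu> \<noteq> 0\<close> show ?thesis
    by (simp add: cut_coeff_def rc_fun_def inner_add_left inner_commute[of "shape P i *v x \<nu>"]
        flip: times_divide_eq_right)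
qed

lemma rc_feasible_subset_master_feasible:
  assumes "well_posed P"
  shows "rc_feasible P \<subseteq> master_feasible P x l"
  by (auto simp: rc_feasible_def master_feasible_def
      intro: order_trans[OF cut_coeff_inner_le_rc_fun[OF assms]])

text \<open>The integers are closed in the reals and coordinates are continuous, so integrality cuts
  a closed set out of a compact box.\<close>

lemma compact_ground_set:
  fixes P :: "('n :: {finite, linorder}) robust_problem"
  shows "compact (ground_set P)"
proof -
  have "ground_set P = cbox (lower P) (upper P)
      \<inter> (\<Inter>j\<in>first_indices (num_int P). (\<lambda>x. x $ j) -` \<int>)"
    by (auto simp: ground_set_def mem_box_cart less_eq_vec_def)
  moreover have "closed ((\<lambda>x :: 'n rvec. x $ j) -` \<int>)" for j
    by (intro continuous_closed_vimage closed_Ints) (auto intro!: continuous_intros)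
  ultimately show ?thesis
    by (auto intro!: compact_Int_closed closed_INT)
qed

lemma compact_master_feasible: "compact (master_feasible P x l)"
proof -
  have "master_feasible P x l = ground_set P
      \<inter> (\<Inter>i\<in>{1..num_cons P}. \<Inter>\<nu>\<in>{..<l}. {y. cut_coeff P x i \<nu> \<bullet> y \<le> 0})"
    by (auto simp: master_feasible_def)
  then show ?thesis
    by (auto intro!: compact_Int_closed compact_ground_set closed_INT closed_halfspace_le)
qed

text \<open>Ensures that the algorithm never gets stuck: a continuous cost attains its minimum on a
  compact set, nonempty because it contains the feasible points of (RC).\<close>

lemma master_optimal_exists:
  assumes "well_posed P" and "rc_feasible P \<noteq> {}"
  shows "\<exists>y. master_optimal P x l y"
proof -
  have "master_feasible P x l \<noteq> {}"
    using rc_feasible_subset_master_feasible assms by blast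
  then obtain y where "y \<in> master_feasible P x l"
    "\<forall>z\<in>master_feasible P x l. cost P \<bullet> y \<le> cost P \<bullet> z"
    using continuous_attains_inf[OF compact_master_feasible _ continuous_on_inner[OF continuous_on_const continuous_on_id]]
    by metis
  then show ?thesis
    by (auto simp: master_optimal_def is_arg_min_def not_less)
qed

lemma master_optimal_ground_set: "master_optimal P x l y \<Longrightarrow> y \<in> ground_set P"
  by (simp add: master_optimal_def is_arg_min_def master_feasible_def)

lemma master_optimal_cost_le:
  assumes "well_posed P" and "master_optimal P x l y" and "z \<in> rc_feasible P"
  shows "cost P \<bullet> y \<le> cost P \<bullet> z"
  using assms rc_feasible_subset_master_feasible[of P x l]
  by (auto simp: master_optimal_def is_arg_min_def not_less)

lemma iterates_separated:
  assumes wp: "well_posed P" and opt: "master_optimal P x l (x l)"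
    and ns: "\<not> stops_at P \<epsilon> (x \<nu>)" and "\<nu> \<noteq> 0" "\<nu> < l"
  shows "\<exists>i\<in>{1..num_cons P}. \<epsilon> \<le> rc_fun P i (x \<nu> - x l)"
proof -
  from ns obtain i where i: "i \<in> {1..num_cons P}" "\<epsilon> \<le> rc_fun P i (x \<nu>)"
    by (auto simp: stops_at_def not_less)
  have "cut_coeff P x i \<nu> \<bullet> x l \<le> 0"
    using opt i(1) \<open>\<nu> < l\<close> by (auto simp: master_optimal_def is_arg_min_def master_feasible_def)
  then have "\<epsilon> \<le> cut_coeff P x i \<nu> \<bullet> (x \<nu> - x l)"
    using i(2) cut_coeff_inner_self[OF wp i(1) \<open>\<nu> \<noteq> 0\<close>, of x] by (simp add: inner_diff_right)
  also have "\<dots> \<le> rc_fun P i (x \<nu> - x l)"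
    by (rule cut_coeff_inner_le_rc_fun[OF wp i(1)])
  finally show ?thesis
    using i(1) by blast
qed

text \<open>Continuity at 0 gives a radius for each constraint, and finitely many constraints share
  one. This turns the separation of iterates into a lower bound on their distance.\<close>

lemma rc_fun_uniformly_small_near_0:
  assumes "\<epsilon> > 0"
  obtains \<delta> where "\<delta> > 0" "\<And>w i. norm w < \<delta> \<Longrightarrow> i \<in> {1..num_cons P} \<Longrightarrow> rc_fun P i w < \<epsilon>"
proof -
  have "\<forall>\<^sub>F w in nhds 0. rc_fun P i w < \<epsilon>" for i
  proof -
    have "isCont (rc_fun P i) 0"
      using continuous_on_rc_fun[of UNIV P i] by (simp add: continuous_on_eq_continuous_at)
    then have "(rc_fun P i \<longlongrightarrow> 0) (nhds 0)"
      by (metis isCont_def rc_fun_0 tendsto_at_iff_tendsto_nhds)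
    with assms show ?thesis
      by (rule order_tendstoD(2)[rotated])
  qed
  then have "\<forall>\<^sub>F w in nhds 0. \<forall>i\<in>{1..num_cons P}. rc_fun P i w < \<epsilon>"
    by (intro eventually_ball_finite) auto
  then show thesis
    using that by (auto simp: eventually_nhds_metric)
qed

lemma cp_execution_stops:
  assumes wp: "well_posed P" and "\<epsilon> > 0" and ex: "cp_execution P \<epsilon> x"
  shows "\<exists>l\<ge>1. stops_at P \<epsilon> (x l)"
proof (rule ccontr)
  assume "\<not> ?thesis"
  then have ns: "\<not> stops_at P \<epsilon> (x l)" if "l \<ge> 1" for l
    using that by blast
  then have opt: "master_optimal P x l (x l)" if "l \<ge> 1" for l
  proof -
    have "cp_run P \<epsilon> l x"
      using ex ns by (auto simp: cp_execution_def)
    with that show ?thesis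
      by (auto simp: cp_run_def)
  qed
  obtain \<delta> where "\<delta> > 0"
    and \<delta>: "\<And>w i. norm w < \<delta> \<Longrightarrow> i \<in> {1..num_cons P} \<Longrightarrow> rc_fun P i w < \<epsilon>"
    using rc_fun_uniformly_small_near_0[OF \<open>\<epsilon> > 0\<close>] by metis
  \<comment> \<open>The index is shifted because \<open>x 0\<close> is not an iterate.\<close>
  have "\<forall>n. x (Suc n) \<in> ground_set P"
    using opt master_optimal_ground_set by (metis le_add1 plus_1_eq_Suc)
  then obtain y r where "strict_mono r" and lim: "((\<lambda>n. x (Suc n)) \<circ> r) \<longlonglongrightarrow> y"
    using compact_ground_set[unfolded compact_def] by metis
  obtain M where "\<forall>m\<ge>M. \<forall>n\<ge>M. dist (x (Suc (r m))) (x (Suc (r n))) < \<delta>"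
    using LIMSEQ_imp_Cauchy[OF lim] \<open>\<delta> > 0\<close> by (auto simp: Cauchy_def)
  \<comment> \<open>Two successive terms of the convergent subsequence are close, yet they are an
    earlier and a later iterate since \<open>r\<close> is strictly increasing.\<close>
  then have "norm (x (Suc (r M)) - x (Suc (r (Suc M)))) < \<delta>"
    by (simp add: dist_norm)
  moreover have "\<exists>i\<in>{1..num_cons P}. \<epsilon> \<le> rc_fun P i (x (Suc (r M)) - x (Suc (r (Suc M))))"
    using \<open>strict_mono r\<close> by (intro iterates_separated[OF wp opt ns]) (auto simp: strict_mono_Suc_iff)
  ultimately show False
    using \<delta> by force
qed

text \<open>An optimum of a relaxation that is feasible for (RC) is optimal there; under the second
  test, its cost is still a lower bound for the infimum.\<close>

lemma rc_solution_within_stop: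
  assumes wp: "well_posed P" and ne: "rc_feasible P \<noteq> {}"
    and opt: "master_optimal P x l y" and stop: "stops_at P \<epsilon> y"
  shows "rc_solution_within P \<epsilon> y"
  using stop unfolding stops_at_def
proof
  assume "\<forall>i\<in>{1..num_cons P}. rc_fun P i y \<le> 0"
  then have "rc_optimal P y"
    using master_optimal_ground_set[OF opt] master_optimal_cost_le[OF wp opt]
    by (auto simp: rc_optimal_def is_arg_min_def rc_feasible_def not_less)
  then show ?thesis
    by (simp add: rc_solution_within_def)
next
  assume "\<forall>i\<in>{1..num_cons P}. rc_fun P i y < \<epsilon>"
  moreover have "cost P \<bullet> y \<le> rc_value P"
    unfolding rc_value_def by (rule cINF_greatest[OF ne master_optimal_cost_le[OF wp opt]])
  ultimately show ?thesis
    using master_optimal_ground_set[OF opt] by (simp add: rc_solution_within_def)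
qed

text \<open>The first conjunct states progress, so that the second, on termination and correctness,
  is not vacuous for want of executions.\<close>

theorem theorem3p1:
  fixes P :: "('n :: {finite, linorder}) robust_problem" and \<epsilon> :: real
  assumes "well_posed P"
    and "\<exists>x. rc_optimal P x"
    and "\<epsilon> > 0"
  shows "(\<forall>N x. cp_run P \<epsilon> N x \<and> (\<forall>l\<in>{1..N}. \<not> stops_at P \<epsilon> (x l))
            \<longrightarrow> (\<exists>y. master_optimal P x (Suc N) y)) \<and>
         (\<forall>x. cp_execution P \<epsilon> x
            \<longrightarrow> (\<exists>L\<ge>1. cp_run P \<epsilon> L x \<and> stops_at P \<epsilon> (x L) \<and> rc_solution_within P \<epsilon> (x L)))"
proof -
  have ne: "rc_feasible P \<noteq> {}"
    using assms(2) by (auto simp: rc_optimal_def is_arg_min_def)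
  have "\<exists>L\<ge>1. cp_run P \<epsilon> L x \<and> stops_at P \<epsilon> (x L) \<and> rc_solution_within P \<epsilon> (x L)"
    if ex: "cp_execution P \<epsilon> x" for x
  proof -
    \<comment> \<open>The first stopping index is taken because \<open>cp_run\<close> demands that
      no earlier iterate stops, and later entries are arbitrary.\<close>
    define L where "L = (LEAST l. l \<ge> 1 \<and> stops_at P \<epsilon> (x l))"
    have L: "L \<ge> 1" "stops_at P \<epsilon> (x L)"
      using LeastI_ex[OF cp_execution_stops[OF assms(1,3) ex]] by (auto simp: L_def)
    have "\<forall>l\<in>{1..<L}. \<not> stops_at P \<epsilon> (x l)"
      using not_less_Least L_def by fastforce
    then have run: "cp_run P \<epsilon> L x"
      using ex by (auto simp: cp_execution_def)
    then have "master_optimal P x L (x L)"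
      using L(1) by (auto simp: cp_run_def)
    with L run rc_solution_within_stop[OF assms(1) ne] show ?thesis
      by blast
  qed
  then show ?thesis
    using master_optimal_exists[OF assms(1) ne] by blast
qed

end
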